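(* Let $s,l\in\mathbb{N}$, $k_1,\dots,k_l,t_1,\dots,t_l\in\mathbb{N}'$ and $m_1,\dots,m_l\in\mathbb{Z}$, let $(G_n)$ be a bivariate Gibonacci polynomial sequence, and put $K=t_1k_1+\cdots+t_lk_l$. Then for all $n\in\mathbb{N}'$, $$G_{st_1n+m_1}^{k_1}\cdots G_{st_ln+m_l}^{k_l}=(-1)^{s+1}\sum_{i=0}^{K}\sum_{j=0}^{i}(-1)^{\frac{(sj+2(s+1))(j+1)}{2}}\binom{K+1}{j}_{F_s}G_{m_1+st_1(i-j)}^{k_1}\cdots G_{m_l+st_l(i-j)}^{k_l}\,y^{\frac{sj(j-1)}{2}}\binom{n+K-i}{K}_{F_s}.$$
   Context: $\mathbb{N}=\{1,2,\dots\}$, $\mathbb{N}'=\mathbb{N}\cup\{0\}$. $x,y$ are indeterminates and we abbreviate $F_n=F_n(x,y)$, $G_n=G_n(x,y)$. The bivariate Fibonacci polynomials are $F_0=0$, $F_1=1$, $F_{n+2}=xF_{n+1}+yF_n$, extended to negative indices by $F_{-n}=-(-y)^{-n}F_n$ ($n\in\mathbb{N}$). A bivariate Gibonacci polynomial sequence $(G_n)$ is given by $G_n=xG_{n-1}+yG_{n-2}$ with arbitrary initial conditions $G_0,G_1$ (elements of $\mathbb{C}(x,y)$, e.g. polynomials), extended to all integer indices by the same recurrence, equivalently $G_n=yG_0F_{n-1}+G_1F_n$ for all $n\in\mathbb{Z}$. For $n,k\in\mathbb{N}'$ the bivariate $s$-Fibopolynomial is $\binom{n}{k}_{F_s}=\frac{F_{sn}F_{s(n-1)}\cdots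 F_{s(n-k+1)}}{F_sF_{2s}\cdots F_{ks}}$ (equal to $1$ for $k=0$ and $k=n$, and to $0$ if $k>n$). Zeroth powers equal $1$. *)

theory Defs
  imports Complex_Main "HOL-Computational_Algebra.Computational_Algebra"
begin

text \<open>The field \<open>\<complex>(x,y)\<close> is the fraction field of \<open>\<complex>[x][y]\<close>: the inner polynomial variable
  is \<open>x\<close>, the outer one is \<open>y\<close>.\<close>

type_synonym ratfun = "complex poly poly fract"

definition X :: ratfun where
  "X = Fract [:[:0, 1:]:] 1"

definition Y :: ratfun where
  "Y = Fract [:0, 1:] 1"

fun bfib_nat :: "nat \<Rightarrow> ratfun" where
  "bfib_nat 0 = 0"
| "bfib_nat (Suc 0) = 1"
| "bfib_nat (Suc (Suc n)) = X * bfib_nat (Suc n) + Y * bfib_nat n"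

text \<open>For negative \<open>n\<close> this is \<open>F\<^sub>-\<^sub>m = -(-y)\<^sup>-\<^sup>m F\<^sub>m\<close> with \<open>m = -n\<close>.\<close>

definition bfib :: "int \<Rightarrow> ratfun" where
  "bfib n = (if n \<ge> 0 then bfib_nat (nat n) else - ((- Y) powi n) * bfib_nat (nat (- n)))"

text \<open>The recurrence over all integers determines \<open>G\<close> from arbitrary
  \<open>G 0\<close> and \<open>G 1\<close> in \<open>\<complex>(x,y)\<close>, since \<open>Y\<close> is invertible.\<close>

definition gibonacci :: "(int \<Rightarrow> ratfun) \<Rightarrow> bool" where
  "gibonacci G \<longleftrightarrow> (\<forall>n. G n = X * G (n - 1) + Y * G (n - 2))"

text \<open>For \<open>k > n\<close> the numerator contains the factor \<open>bfib 0 = 0\<close>, so the value is \<open>0\<close>.\<close>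

definition fibopoly :: "nat \<Rightarrow> nat \<Rightarrow> nat \<Rightarrow> ratfun" where
  "fibopoly s n k =
     (\<Prod>i<k. bfib (int s * (int n - int i))) / (\<Prod>i=1..k. bfib (int i * int s))"

end

theory Submission
  imports "HOL-Algebra.Algebraic_Closure_Type" Defs
begin

text \<open>Over the algebraic closure of \<open>\<complex>(x,y)\<close> write \<open>x = \<alpha> + \<beta>\<close>, \<open>y = -\<alpha>\<beta>\<close>, and put \<open>a = \<alpha>\<^sup>s\<close>,
  \<open>b = \<beta>\<^sup>s\<close>. By Binet's formulas the \<open>s\<close>-Fibopolynomials are the Gaussian binomials in \<open>a\<close>, \<open>b\<close>,
  and the product of Gibonacci polynomials is a combination of the sequences
  \<open>n \<mapsto> (a\<^sup>i b\<^sup>K\<^sup>-\<^sup>i)\<^sup>n\<close>, \<open>0 \<le> i \<le> K\<close>. Hence its generating function \<open>A\<close> times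
  \<open>D = (\<Prod>i\<le>K. 1 - a\<^sup>i b\<^sup>K\<^sup>-\<^sup>i z)\<close> is a polynomial of degree at most \<open>K\<close>. The q-binomial theorem gives
  the coefficients of \<open>D\<close>, its companion those of \<open>1/D\<close>, and the formula compares coefficients in
  \<open>A = (D A) \<cdot> (1/D)\<close>.\<close>

(* HOL-Algebra's notation for polynomial variables would capture the constant X of Defs. *)
no_notation Polynomials.var ("X\<index>")

section \<open>Homogeneous Gaussian binomial coefficients\<close>

text \<open>For \<open>k \<le> n\<close> and \<open>b \<noteq> 0\<close> this is
  \<open>b ^ (k * (n - k))\<close> times the q-binomial coefficient at q = a/b.\<close>

definition hbinom :: "'a::field \<Rightarrow> 'a \<Rightarrow> nat \<Rightarrow> nat \<Rightarrow> 'a" where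
  "hbinom a b n k = (\<Prod>i<k. a ^ (n - i) - b ^ (n - i)) / (\<Prod>i=1..k. a ^ i - b ^ i)"

lemma hbinom_0 [simp]: "hbinom a b n 0 = 1"
  by (simp add: hbinom_def)

lemma hbinom_eq_0: "n < k \<Longrightarrow> hbinom a b n k = 0"
  unfolding hbinom_def by (subst prod_zero) (auto intro!: bexI[of _ n])

lemma hbinom_commute: "hbinom a b n k = hbinom b a n k"
proof -
  have num: "(\<Prod>i<k. a ^ (n - i) - b ^ (n - i)) = (-1) ^ k * (\<Prod>i<k. b ^ (n - i) - a ^ (n - i))"
    by (induction k) (auto simp: algebra_simps)
  have den: "(\<Prod>i=1..k. a ^ i - b ^ i) = (-1) ^ k * (\<Prod>i=1..k. b ^ i - a ^ i)"
    by (induction k) (auto simp: algebra_simps)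
  show ?thesis
    unfolding hbinom_def num den by simp
qed

lemma hbinom_diag:
  assumes "\<And>i. i \<ge> 1 \<Longrightarrow> a ^ i \<noteq> b ^ i"
  shows "hbinom a b k k = 1"
proof -
  have "(\<Prod>i<k. a ^ (k - i) - b ^ (k - i)) = (\<Prod>i=1..k. a ^ i - b ^ i)"
    by (rule prod.reindex_bij_witness[of _ "\<lambda>i. k - i" "\<lambda>i. k - i"]) auto
  moreover have "(\<Prod>i=1..k. a ^ i - b ^ i) \<noteq> 0"
    using assms by auto
  ultimately show ?thesis
    by (simp add: hbinom_def)
qed

text \<open>The q-Pascal rule, from splitting the new numerator factor as
  \<open>c (Suc n) = a ^ Suc k * c (n - k) + b ^ (n - k) * c (Suc k)\<close>, where
  \<open>c i = a ^ i - b ^ i\<close>.\<close>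

lemma hbinom_Suc_Suc:
  assumes "\<And>i. i \<ge> 1 \<Longrightarrow> a ^ i \<noteq> b ^ i" and "k \<le> n"
  shows "hbinom a b (Suc n) (Suc k) = a ^ Suc k * hbinom a b n (Suc k) + b ^ (n - k) * hbinom a b n k"
proof -
  define c where "c = (\<lambda>i. a ^ i - b ^ i)"
  have nz: "c (Suc k) \<noteq> 0"
    using assms(1)[of "Suc k"] by (simp add: c_def)
  have l: "hbinom a b (Suc n) (Suc k) = c (Suc n) * hbinom a b n k / c (Suc k)"
    unfolding hbinom_def c_def by (subst prod.lessThan_Suc_shift) simp
  have r: "hbinom a b n (Suc k) = hbinom a b n k * c (n - k) / c (Suc k)"
    unfolding hbinom_def c_def by simp
  obtain d where n: "n = k + d"
    using assms(2) le_Suc_ex by blast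
  have "c (Suc n) = a ^ Suc k * c (n - k) + b ^ (n - k) * c (Suc k)"
    unfolding c_def n by (simp add: algebra_simps power_add)
  then show ?thesis
    unfolding l r using nz by (simp add: field_simps)
qed

section \<open>The q-binomial theorem and its reciprocal\<close>

text \<open>The reversed characteristic polynomial of all sequences
  \<open>n \<mapsto> (a\<^sup>i b\<^sup>j)\<^sup>n\<close> with \<open>i + j = N - 1\<close>.\<close>

definition rev_char :: "'a::field \<Rightarrow> 'a \<Rightarrow> nat \<Rightarrow> 'a fps" where
  "rev_char a b N = (\<Prod>i<N. 1 - fps_const (a ^ i * b ^ (N - 1 - i)) * fps_X)"

text \<open>Substituting bz for z raises the exponent of \<open>b\<close> in every factor by one,
  which yields the factors with \<open>i < N\<close>; the factor for \<open>i = N\<close> is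
  new.\<close>

lemma rev_char_Suc:
  "rev_char a b (Suc N) =
     (rev_char a b N oo (fps_const b * fps_X)) * (1 - fps_const (a ^ N) * fps_X)"
proof -
  have "(1 - fps_const (a ^ i * b ^ (N - 1 - i)) * fps_X) oo (fps_const b * fps_X) =
        1 - fps_const (a ^ i * b ^ (N - i)) * fps_X" if "i < N" for i
  proof -
    have "b ^ (N - i) = b * b ^ (N - 1 - i)"
      using that by (metis Suc_diff_Suc diff_Suc_eq_diff_pred power_Suc)
    then show ?thesis
      by (auto simp: fps_eq_iff fps_X_nth le_Suc_eq)
  qed
  then have "rev_char a b N oo (fps_const b * fps_X) =
        (\<Prod>i<N. 1 - fps_const (a ^ i * b ^ (N - i)) * fps_X)"
    unfolding rev_char_def
    by (subst fps_compose_prod_distrib) (auto intro!: prod.cong)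
  then show ?thesis
    by (simp add: rev_char_def)
qed

lemma triangular_Suc: "Suc j * (Suc j - 1) div 2 = j * (j - 1) div 2 + j"
proof -
  have "Suc j * (Suc j - 1) = j * (j - 1) + 2 * j"
    by (cases j) auto
  then show ?thesis
    by simp
qed

text \<open>The q-binomial theorem: comparing coefficients in \<open>rev_char_Suc\<close> gives a
  recurrence in \<open>N\<close> that matches the q-Pascal rule.\<close>

lemma rev_char_nth:
  assumes ne: "\<And>i. i \<ge> 1 \<Longrightarrow> a ^ i \<noteq> b ^ i"
  shows "rev_char a b N $ j = (-1) ^ j * (a * b) ^ (j * (j - 1) div 2) * hbinom a b N j"
proof (induction N arbitrary: j)
  case 0
  then show ?case
    by (cases j) (auto simp: rev_char_def hbinom_eq_0)
next
  case (Suc N)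
  show ?case
  proof (cases j)
    case 0
    then show ?thesis
      by (simp add: rev_char_Suc fps_compose_linear Suc)
  next
    case (Suc i)
    have split: "rev_char a b (Suc N) $ Suc i =
        b ^ Suc i * rev_char a b N $ Suc i - a ^ N * (b ^ i * rev_char a b N $ i)"
    proof -
      have "rev_char a b (Suc N) = (rev_char a b N oo (fps_const b * fps_X)) -
          fps_const (a ^ N) * (fps_X * (rev_char a b N oo (fps_const b * fps_X)))"
        by (simp add: rev_char_Suc algebra_simps)
      then show ?thesis
        by (simp add: fps_compose_linear del: power_Suc)
    qed
    show ?thesis
    proof (cases "i \<le> N")
      case True
      \<comment> \<open>In \<open>split\<close> the power of \<open>b\<close> multiplies the
        coefficient at \<open>Suc i\<close>, so the Pascal rule is used with \<open>a\<close> and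
        \<open>b\<close> exchanged.\<close>
      have ne': "b ^ k \<noteq> a ^ k" if "k \<ge> 1" for k
        using ne[OF that] by metis
      have pascal: "hbinom a b (Suc N) (Suc i) =
          b ^ Suc i * hbinom a b N (Suc i) + a ^ (N - i) * hbinom a b N i"
        using hbinom_Suc_Suc[OF ne' True] by (simp add: hbinom_commute[of a b])
      have aN: "a ^ N = a ^ (N - i) * a ^ i"
        using True by (simp flip: power_add)
      show ?thesis
        unfolding Suc split Suc.IH triangular_Suc pascal aN
        by (simp add: power_add power_mult_distrib algebra_simps)
    next
      case False
      then show ?thesis
        unfolding Suc split Suc.IH by (simp add: hbinom_eq_0)
    qed
  qed
qed

text \<open>By the Pascal rule, the last factor of the product turns the series for
  \<open>Suc K\<close> into the series for \<open>K\<close> at bz, where the induction hypothesis,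
  also taken at bz, applies.\<close>

lemma rev_char_mult_hbinom:
  assumes ne: "\<And>i. i \<ge> 1 \<Longrightarrow> a ^ i \<noteq> b ^ i"
  shows "rev_char a b (Suc K) * Abs_fps (\<lambda>n. hbinom a b (n + K) K) = 1"
proof (induction K)
  case 0
  have "(1 - fps_X) * Abs_fps (\<lambda>_. 1) = (1 :: 'a fps)"
    by (simp add: fps_eq_iff left_diff_distrib)
  then show ?case
    by (simp add: rev_char_def)
next
  case (Suc K)
  let ?H = "\<lambda>K. Abs_fps (\<lambda>n. hbinom a b (n + K) K)"
  let ?s = "fps_const b * fps_X"
  have shift: "(1 - fps_const (a ^ Suc K) * fps_X) * ?H (Suc K) = ?H K oo ?s"
  proof (rule fps_ext)
    fix n
    show "((1 - fps_const (a ^ Suc K) * fps_X) * ?H (Suc K)) $ n = (?H K oo ?s) $ n"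
    proof (cases n)
      case 0
      then show ?thesis
        using hbinom_diag[OF ne] by (simp add: fps_compose_linear left_diff_distrib mult.assoc)
    next
      case (Suc m)
      have "hbinom a b (Suc (m + Suc K)) (Suc K) =
          a ^ Suc K * hbinom a b (m + Suc K) (Suc K) + b ^ Suc m * hbinom a b (Suc m + K) K"
        using hbinom_Suc_Suc[OF ne, of K "m + Suc K"] by simp
      then show ?thesis
        unfolding Suc
        by (simp add: fps_compose_linear left_diff_distrib mult.assoc del: power_Suc)
    qed
  qed
  have "rev_char a b (Suc (Suc K)) * ?H (Suc K) =
      (rev_char a b (Suc K) oo ?s) * ((1 - fps_const (a ^ Suc K) * fps_X) * ?H (Suc K))"
    by (simp add: rev_char_Suc[of a b "Suc K"] mult.assoc)
  also have "\<dots> = (rev_char a b (Suc K) * ?H K) oo ?s"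
    unfolding shift by (simp add: fps_compose_mult_distrib)
  finally show ?case
    by (simp add: Suc.IH)
qed

section \<open>Expansion of sequences with binary characteristic roots\<close>

lemma prod_linear_nth_eq_0:
  fixes c :: "'b \<Rightarrow> 'a::field"
  assumes "finite S" and "card S < n"
  shows "(\<Prod>i\<in>S. 1 - fps_const (c i) * fps_X) $ n = 0"
  using assms
proof (induction S arbitrary: n rule: finite_induct)
  case empty
  then show ?case by simp
next
  case (insert x S)
  then obtain m where "n = Suc m" "card S < m"
    by (cases n) auto
  with insert show ?case
    by (simp add: left_diff_distrib mult.assoc)
qed

text \<open>Each geometric series cancels the factor with its own index, leaving a combination of
  products of \<open>K\<close> linear factors.\<close>

lemma rev_char_mult_nth_eq_0:
  assumes f: "\<And>n. f n = (\<Sum>i\<le>K. e i * (a ^ i * b ^ (K - i)) ^ n)" and "K < n"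
  shows "(rev_char a b (Suc K) * Abs_fps f) $ n = 0"
proof -
  define q where "q = (\<lambda>i. a ^ i * b ^ (K - i))"
  define L where "L = (\<lambda>i. 1 - fps_const (q i) * fps_X)"
  have D: "rev_char a b (Suc K) = prod L {..K}"
    by (simp add: rev_char_def L_def q_def lessThan_Suc_atMost)
  have geom: "L i * Abs_fps (\<lambda>n. q i ^ n) = 1" for i
  proof (rule fps_ext)
    fix n show "(L i * Abs_fps (\<lambda>n. q i ^ n)) $ n = 1 $ n"
      by (cases n) (simp_all add: L_def left_diff_distrib mult.assoc)
  qed
  have "Abs_fps f = (\<Sum>i\<le>K. fps_const (e i) * Abs_fps (\<lambda>n. q i ^ n))"
    by (simp add: fps_eq_iff fps_sum_nth f q_def)
  then have "rev_char a b (Suc K) * Abs_fps f =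
      (\<Sum>i\<le>K. fps_const (e i) * (prod L {..K} * Abs_fps (\<lambda>n. q i ^ n)))"
    by (simp add: D sum_distrib_left mult_ac)
  also have "\<dots> = (\<Sum>i\<le>K. fps_const (e i) * prod L ({..K} - {i}))"
  proof (rule sum.cong)
    fix i assume "i \<in> {..K}"
    then have "prod L {..K} * Abs_fps (\<lambda>n. q i ^ n) =
        prod L ({..K} - {i}) * (L i * Abs_fps (\<lambda>n. q i ^ n))"
      by (simp add: prod.remove[of _ i] mult_ac)
    then show "fps_const (e i) * (prod L {..K} * Abs_fps (\<lambda>n. q i ^ n)) =
        fps_const (e i) * prod L ({..K} - {i})"
      by (simp add: geom)
  qed simp
  finally have "(rev_char a b (Suc K) * Abs_fps f) $ n =
      (\<Sum>i\<le>K. e i * prod L ({..K} - {i}) $ n)"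
    by (simp add: fps_sum_nth)
  moreover have "prod L ({..K} - {i}) $ n = 0" if "i \<le> K" for i
    unfolding L_def by (rule prod_linear_nth_eq_0) (use that assms(2) in simp_all)
  ultimately show ?thesis
    by simp
qed

lemma hbinom_expansion:
  assumes ne: "\<And>i. i \<ge> 1 \<Longrightarrow> a ^ i \<noteq> b ^ i"
    and f: "\<And>n. f n = (\<Sum>i\<le>K. e i * (a ^ i * b ^ (K - i)) ^ n)"
  shows "f n = (\<Sum>i=0..K. \<Sum>j=0..i. (-1) ^ j * (a * b) ^ (j * (j - 1) div 2) *
            hbinom a b (K + 1) j * f (i - j) * hbinom a b (n + K - i) K)"
proof -
  define c where "c = (\<lambda>i. (rev_char a b (Suc K) * Abs_fps f) $ i)"
  let ?H = "Abs_fps (\<lambda>n. hbinom a b (n + K) K)"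
  have "Abs_fps f = (rev_char a b (Suc K) * ?H) * Abs_fps f"
    using rev_char_mult_hbinom[OF ne, of K] by simp
  then have "f n = ((rev_char a b (Suc K) * Abs_fps f) * ?H) $ n"
    by (metis (no_types, lifting) fps_nth_Abs_fps mult.assoc mult.commute)
  also have "\<dots> = (\<Sum>i=0..n. c i * hbinom a b (n - i + K) K)"
    by (simp add: fps_mult_nth c_def)
  also have "\<dots> = (\<Sum>i=0..n. c i * hbinom a b (n + K - i) K)"
    by (intro sum.cong) auto
  \<comment> \<open>Both ranges embed in \<open>{0..max n K}\<close>: for \<open>i > n\<close> the
    binomial vanishes as \<open>n + K - i < K\<close>, and for \<open>i > K\<close> the coefficient
    \<open>c i\<close> vanishes by the degree bound.\<close>
  also have "\<dots> = (\<Sum>i=0..max n K. c i * hbinom a b (n + K - i) K)"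
    by (rule sum.mono_neutral_left) (auto simp: hbinom_eq_0)
  also have "\<dots> = (\<Sum>i=0..K. c i * hbinom a b (n + K - i) K)"
    by (rule sum.mono_neutral_right) (auto simp: c_def rev_char_mult_nth_eq_0[OF f])
  also have "\<dots> = (\<Sum>i=0..K. \<Sum>j=0..i. (-1) ^ j * (a * b) ^ (j * (j - 1) div 2) *
            hbinom a b (K + 1) j * f (i - j) * hbinom a b (n + K - i) K)"
    by (simp add: c_def fps_mult_nth rev_char_nth[OF ne] sum_distrib_right)
  finally show ?thesis .
qed

text \<open>Dehomogenizing by \<open>b\<^sup>n\<close> turns the product into a polynomial in \<open>(a/b)\<^sup>n\<close>, for which
  the degree bound is immediate.\<close>

lemma prod_power_binary_form:
  fixes a b :: "'a::field" and c d :: "'b \<Rightarrow> 'a"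
  assumes "b \<noteq> 0" and "finite R"
  obtains e where "\<And>n. (\<Prod>r\<in>R. (c r * a ^ (t r * n) + d r * b ^ (t r * n)) ^ k r) =
    (\<Sum>i\<le>(\<Sum>r\<in>R. t r * k r). e i * (a ^ i * b ^ ((\<Sum>r\<in>R. t r * k r) - i)) ^ n)"
proof -
  define K where "K = (\<Sum>r\<in>R. t r * k r)"
  \<comment> \<open>The r-th base divided by \<open>b ^ (t r * n)\<close>, as a polynomial in u =
    (a/b)^n.\<close>
  define p where "p = (\<lambda>r. Polynomial.monom (c r) (t r) + [:d r:])"
  define P where "P = (\<Prod>r\<in>R. p r ^ k r)"
  have "Polynomial.degree (p r) \<le> t r" for r
    unfolding p_def by (intro degree_add_le degree_monom_le) auto
  then have "Polynomial.degree (p r ^ k r) \<le> t r * k r" for r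
    using degree_power_le[of "p r" "k r"] by (meson le_trans mult_le_mono1)
  then have "(\<Sum>r\<in>R. Polynomial.degree (p r ^ k r)) \<le> K"
    unfolding K_def by (intro sum_mono)
  then have deg: "Polynomial.degree P \<le> K"
    unfolding P_def using degree_prod_sum_le[OF assms(2), of "\<lambda>r. p r ^ k r"]
    by simp
  have "(\<Prod>r\<in>R. (c r * a ^ (t r * n) + d r * b ^ (t r * n)) ^ k r) =
    (\<Sum>i\<le>K. Polynomial.coeff P i * (a ^ i * b ^ (K - i)) ^ n)" for n
  proof -
    have "c r * a ^ (t r * n) + d r * b ^ (t r * n) = (b ^ n) ^ t r * poly (p r) ((a / b) ^ n)" for r
      using assms(1) by (simp add: p_def poly_monom field_simps flip: power_mult)
    then have "(\<Prod>r\<in>R. (c r * a ^ (t r * n) + d r * b ^ (t r * n)) ^ k r) =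
        (b ^ n) ^ K * poly P ((a / b) ^ n)"
      by (simp add: power_mult_distrib prod.distrib poly_prod P_def K_def power_sum
            mult.assoc flip: power_mult)
    also have "poly P ((a / b) ^ n) = (\<Sum>i\<le>K. Polynomial.coeff P i * ((a / b) ^ n) ^ i)"
      unfolding poly_altdef
      by (rule sum.mono_neutral_left) (use deg in \<open>auto simp: Polynomial.coeff_eq_0\<close>)
    also have "(b ^ n) ^ K * \<dots> = (\<Sum>i\<le>K. Polynomial.coeff P i * (a ^ i * b ^ (K - i)) ^ n)"
      unfolding sum_distrib_left
    proof (rule sum.cong)
      fix i assume "i \<in> {..K}"
      then have "b ^ K = b ^ (K - i) * b ^ i"
        by (simp flip: power_add)
      then have "b ^ K * (a / b) ^ i = a ^ i * b ^ (K - i)"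
        using assms(1) by (simp add: field_simps)
      then have "(b ^ K * (a / b) ^ i) ^ n = (a ^ i * b ^ (K - i)) ^ n"
        by simp
      then show "(b ^ n) ^ K * (Polynomial.coeff P i * ((a / b) ^ n) ^ i) =
          Polynomial.coeff P i * (a ^ i * b ^ (K - i)) ^ n"
        by (simp add: power_mult_distrib power_commutes mult_ac flip: power_mult)
    qed simp
    finally show ?thesis .
  qed
  then show ?thesis
    using that unfolding K_def by blast
qed

section \<open>Binet formulas\<close>

lemma Fract_of_one_eq_0_iff: "Fract p 1 = 0 \<longleftrightarrow> p = 0" for p :: "'a::idom"
  by (simp add: Zero_fract_def eq_fract)

lemma Y_nonzero: "Y \<noteq> 0"
  by (simp add: Y_def Fract_of_one_eq_0_iff)

text \<open>As a polynomial in y it has the nonzero linear coefficient 4. Being the squared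
  difference of the Binet roots, it keeps them distinct.\<close>

lemma discriminant_nonzero: "X * X + 4 * Y \<noteq> 0"
proof -
  have four: "4 = Fract (4 :: complex poly poly) 1"
    using of_nat_fract[of 4] by simp
  have "X * X + 4 * Y = Fract ([:[:0, 1:]:] * [:[:0, 1:]:] + 4 * [:0, 1:]) 1"
    by (simp only: X_def Y_def four mult_fract add_fract one_neq_zero not_False_eq_True mult_1_right)
  also have "\<dots> \<noteq> 0"
    unfolding Fract_of_one_eq_0_iff by (simp add: numeral_poly)
  finally show ?thesis .
qed

text \<open>At \<open>y = 0\<close> the polynomial \<open>F\<^sub>n\<^sub>+\<^sub>1\<close> specializes to \<open>x\<^sup>n\<close>.\<close>

lemma bfib_nat_nonzero: "bfib_nat (Suc n) \<noteq> 0"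
proof -
  have "\<exists>p. bfib_nat n = Fract p 1 \<and> (n > 0 \<longrightarrow> poly p 0 = [:0, 1:] ^ (n - 1))" for n
  proof (induction n rule: bfib_nat.induct)
    case 1
    show ?case by (rule exI[of _ 0]) (simp add: Zero_fract_def)
  next
    case 2
    show ?case by (rule exI[of _ 1]) (simp add: One_fract_def)
  next
    case (3 n)
    then obtain p q where "bfib_nat (Suc n) = Fract p 1" "poly p 0 = [:0, 1:] ^ n"
      "bfib_nat n = Fract q 1" by auto
    then show ?case
      \<comment> \<open>The witness copies the recurrence; its second summand vanishes at y =
        0.\<close>
      by (intro exI[of _ "[:[:0, 1:]:] * p + [:0, 1:] * q"]) (simp add: X_def Y_def)
  qed
  then obtain p where "bfib_nat (Suc n) = Fract p 1" "poly p 0 = [:0, 1:] ^ n"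
    by (metis diff_Suc_1 zero_less_Suc)
  then show ?thesis
    by (auto simp: Fract_of_one_eq_0_iff)
qed

text \<open>Take a root \<open>\<alpha>\<close> of T^2 - xT - y in the algebraic closure and put
  \<open>\<beta>\<close> = x - \<open>\<alpha>\<close>.\<close>

lemma binet_roots:
  obtains \<alpha> \<beta> :: "ratfun alg_closure"
  where "\<alpha> + \<beta> = to_ac X" and "\<alpha> * \<beta> = - to_ac Y" and "\<alpha> \<noteq> \<beta>"
proof -
  have "Polynomial.degree [:- to_ac Y, - to_ac X, 1:] > 0"
    by simp
  then obtain \<alpha> where "poly [:- to_ac Y, - to_ac X, 1:] \<alpha> = 0"
    using alg_closed_imp_poly_has_root by blast
  then have \<alpha>: "\<alpha> * (to_ac X - \<alpha>) = - to_ac Y"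
    by (simp add: algebra_simps add_eq_0_iff)
  have "to_ac (X * X + 4 * Y) = (\<alpha> - (to_ac X - \<alpha>)) ^ 2"
  proof -
    have Y: "to_ac Y = - (\<alpha> * (to_ac X - \<alpha>))"
      using \<alpha> by simp
    show ?thesis
      by (simp add: Y) (simp add: power2_eq_square algebra_simps)
  qed
  then have "\<alpha> \<noteq> to_ac X - \<alpha>"
    using discriminant_nonzero by (metis diff_self power_zero_numeral to_ac_eq_0_iff)
  then show ?thesis
    using that[of \<alpha> "to_ac X - \<alpha>"] \<alpha> by simp
qed

lemma binet_bfib_nat:
  assumes "\<alpha> + \<beta> = to_ac X" and "\<alpha> * \<beta> = - to_ac Y"
  shows "to_ac (bfib_nat n) * (\<alpha> - \<beta>) = \<alpha> ^ n - \<beta> ^ n"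
proof (induction n rule: bfib_nat.induct)
  case (3 n)
  have Y: "to_ac Y = - (\<alpha> * \<beta>)"
    using assms(2) by simp
  have "to_ac (bfib_nat (Suc (Suc n))) * (\<alpha> - \<beta>) =
      (\<alpha> + \<beta>) * (to_ac (bfib_nat (Suc n)) * (\<alpha> - \<beta>)) - \<alpha> * \<beta> * (to_ac (bfib_nat n) * (\<alpha> - \<beta>))"
    by (simp add: Y algebra_simps flip: assms(1))
  then show ?case
    unfolding 3 by (simp add: algebra_simps)
qed auto

lemma binet_gibonacci:
  assumes "\<alpha> + \<beta> = to_ac X" and "\<alpha> * \<beta> = - to_ac Y" and "\<alpha> \<noteq> \<beta>" and "gibonacci G"
  obtains c d where "\<And>n. to_ac (G (int n + m)) = c * \<alpha> ^ n + d * \<beta> ^ n"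
proof -
  \<comment> \<open>Cramer's rule for the conditions at \<open>n = 0\<close> and
    \<open>n = 1\<close>. Starting at the shift \<open>m\<close> keeps all exponents natural even if
    \<open>m\<close> is negative.\<close>
  define c where "c = (to_ac (G (1 + m)) - \<beta> * to_ac (G m)) / (\<alpha> - \<beta>)"
  define d where "d = (\<alpha> * to_ac (G m) - to_ac (G (1 + m))) / (\<alpha> - \<beta>)"
  have Y: "to_ac Y = - (\<alpha> * \<beta>)"
    using assms(2) by simp
  have "to_ac (G (int n + m)) = c * \<alpha> ^ n + d * \<beta> ^ n" for n
  proof (induction n rule: bfib_nat.induct)
    case 1
    have "c + d = to_ac (G m) * (\<alpha> - \<beta>) / (\<alpha> - \<beta>)"
      unfolding c_def d_def by (simp add: algebra_simps flip: add_divide_distrib)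
    then show ?case
      using assms(3) by simp
  next
    case 2
    have "c * \<alpha> + d * \<beta> = to_ac (G (1 + m)) * (\<alpha> - \<beta>) / (\<alpha> - \<beta>)"
      unfolding c_def d_def by (simp add: algebra_simps flip: add_divide_distrib)
    then show ?case
      using assms(3) by simp
  next
    case (3 n)
    have "G (int (Suc (Suc n)) + m) = X * G (int (Suc n) + m) + Y * G (int n + m)"
      using assms(4)[unfolded gibonacci_def, rule_format, of "int (Suc (Suc n)) + m"]
      by (simp add: algebra_simps)
    then have "to_ac (G (int (Suc (Suc n)) + m)) =
        (\<alpha> + \<beta>) * to_ac (G (int (Suc n) + m)) - \<alpha> * \<beta> * to_ac (G (int n + m))"
      by (simp add: Y flip: assms(1))
    then show ?case
      unfolding 3 by (simp add: algebra_simps)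
  qed
  then show ?thesis
    using that by blast
qed

lemma to_ac_fibopoly:
  assumes "\<alpha> + \<beta> = to_ac X" and "\<alpha> * \<beta> = - to_ac Y" and "\<alpha> \<noteq> \<beta>"
  shows "to_ac (fibopoly s n k) = hbinom (\<alpha> ^ s) (\<beta> ^ s) n k"
proof (cases "k \<le> n")
  case True
  define F where "F = (\<lambda>i. (\<alpha> ^ s) ^ i - (\<beta> ^ s) ^ i)"
  have F: "to_ac (bfib_nat (s * i)) = F i / (\<alpha> - \<beta>)" for i
    using binet_bfib_nat[OF assms(1,2), of "s * i"] assms(3)
    by (simp add: F_def field_simps flip: power_mult)
  \<comment> \<open>Since \<open>k \<le> n\<close>, all indices are nonnegative and integer
    subtraction agrees with the truncated one in \<open>hbinom\<close>.\<close>
  have "bfib (int s * (int n - int i)) = bfib_nat (s * (n - i))" if "i < k" for i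
    using that True by (simp add: bfib_def flip: of_nat_diff of_nat_mult)
  then have num: "to_ac (\<Prod>i<k. bfib (int s * (int n - int i))) = (\<Prod>i<k. F (n - i)) / (\<alpha> - \<beta>) ^ k"
    by (simp add: to_ac_prod F prod_dividef)
  have "bfib (int i * int s) = bfib_nat (s * i)" for i
    by (simp add: bfib_def mult.commute flip: of_nat_mult)
  then have den: "to_ac (\<Prod>i=1..k. bfib (int i * int s)) = (\<Prod>i=1..k. F i) / (\<alpha> - \<beta>) ^ k"
    by (simp add: to_ac_prod F prod_dividef)
  show ?thesis
    unfolding fibopoly_def hbinom_def to_ac_divide num den using assms(3) by (simp add: F_def)
next
  case False
  then have "(\<Prod>i<k. bfib (int s * (int n - int i))) = 0"
    by (intro prod_zero) (auto simp: bfib_def intro!: bexI[of _ n])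
  then show ?thesis
    using False by (simp add: fibopoly_def hbinom_eq_0)
qed

section \<open>Products of Gibonacci polynomials\<close>

text \<open>Matches the sign and power of y in the claim with those of the q-binomial theorem at ab
  = (-y)^s.\<close>

lemma sign_exponent:
  "(-1) ^ (s + 1) * (-1) ^ ((s * j + 2 * (s + 1)) * (j + 1) div 2) * y ^ (s * j * (j - 1) div 2) =
     (-1) ^ j * ((- y) ^ s) ^ (j * (j - 1) div 2)" for y :: "'a::comm_ring_1"
proof -
  define T where "T = j * (j - 1) div 2"
  have T: "j * (j - 1) = 2 * T"
    unfolding T_def by (cases j) auto
  have e1: "s * j * (j - 1) div 2 = s * T"
    using T by (simp add: mult.assoc)
  have j: "j * (j + 1) = 2 * (T + j)"
    using T by (cases j) (auto simp: algebra_simps)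
  have "(s * j + 2 * (s + 1)) * (j + 1) = s * (j * (j + 1)) + 2 * ((s + 1) * (j + 1))"
    by (simp add: algebra_simps)
  also have "\<dots> = 2 * (s * (T + j) + (s + 1) * (j + 1))"
    unfolding j by (simp add: algebra_simps)
  finally have e2: "(s * j + 2 * (s + 1)) * (j + 1) div 2 = s * (T + j) + (s + 1) * (j + 1)"
    by simp
  \<comment> \<open>The two exponents of -1 differ by the even number
    \<open>2 * (s * j + s + 1)\<close>.\<close>
  have "(-1 :: 'a) ^ (s + 1) * (-1) ^ (s * (T + j) + (s + 1) * (j + 1)) = (-1) ^ j * (-1) ^ (s * T)"
    by (cases "even s"; cases "even j"; cases "even T") (simp_all add: minus_one_power_iff)
  then have "(-1) ^ (s + 1) * (-1) ^ (s * (T + j) + (s + 1) * (j + 1)) * y ^ (s * T) =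
      (-1) ^ j * ((-1) ^ (s * T) * y ^ (s * T))"
    by (simp add: mult.assoc)
  also have "(-1) ^ (s * T) * y ^ (s * T) = ((- y) ^ s) ^ T"
    by (simp add: power_mult power_minus[of y s] power_mult_distrib)
  finally show ?thesis
    unfolding e1 e2 T_def[symmetric] .
qed

theorem corollary9:
  fixes s l K n :: nat and k t :: "nat \<Rightarrow> nat" and m :: "nat \<Rightarrow> int"
    and G :: "int \<Rightarrow> ratfun"
  assumes "s \<ge> 1" and "l \<ge> 1"
    and "gibonacci G"
    and "K = (\<Sum>r=1..l. t r * k r)"
  shows "(\<Prod>r=1..l. G (int (s * t r * n) + m r) ^ k r) =
    (- 1) ^ (s + 1) *
    (\<Sum>i=0..K. \<Sum>j=0..i.
       (- 1) ^ ((s * j + 2 * (s + 1)) * (j + 1) div 2) *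
       fibopoly s (K + 1) j *
       (\<Prod>r=1..l. G (m r + int (s * t r * (i - j))) ^ k r) *
       Y ^ (s * j * (j - 1) div 2) *
       fibopoly s (n + K - i) K)"
proof -
  obtain \<alpha> \<beta> where \<alpha>\<beta>: "\<alpha> + \<beta> = to_ac X" "\<alpha> * \<beta> = - to_ac Y" "\<alpha> \<noteq> \<beta>"
    by (rule binet_roots)
  define a b where "a = \<alpha> ^ s" and "b = \<beta> ^ s"
  define f where "f = (\<lambda>n. \<Prod>r=1..l. G (int (s * t r * n) + m r) ^ k r)"
  have "\<beta> \<noteq> 0"
    using \<alpha>\<beta>(2) Y_nonzero by auto
  then have "b \<noteq> 0"
    by (simp add: b_def)
  have ab: "a * b = (- to_ac Y) ^ s"
    by (simp add: a_def b_def \<alpha>\<beta>(2) flip: power_mult_distrib)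
  \<comment> \<open>By Binet, equality would force F_(si) = 0.\<close>
  have ne: "a ^ i \<noteq> b ^ i" if "i \<ge> 1" for i
  proof -
    obtain p where "s * i = Suc p"
      using assms(1) \<open>i \<ge> 1\<close> by (cases "s * i") auto
    then have "to_ac (bfib_nat (s * i)) \<noteq> 0"
      by (metis bfib_nat_nonzero to_ac_eq_0_iff)
    then show ?thesis
      using binet_bfib_nat[OF \<alpha>\<beta>(1,2), of "s * i"] \<alpha>\<beta>(3)
      by (auto simp: a_def b_def power_mult)
  qed
  have "\<exists>c d. \<forall>n. to_ac (G (int n + m r)) = c * \<alpha> ^ n + d * \<beta> ^ n" for r
    using binet_gibonacci[OF \<alpha>\<beta> assms(3)] by metis
  then obtain c d where cd: "\<And>r n. to_ac (G (int n + m r)) = c r * \<alpha> ^ n + d r * \<beta> ^ n"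
    by metis
  have fn: "to_ac (f n) = (\<Prod>r=1..l. (c r * a ^ (t r * n) + d r * b ^ (t r * n)) ^ k r)" for n
    unfolding f_def a_def b_def to_ac_prod to_ac_power cd by (simp add: mult.assoc power_mult)
  obtain e where e: "\<And>n. to_ac (f n) = (\<Sum>i\<le>K. e i * (a ^ i * b ^ (K - i)) ^ n)"
    unfolding fn assms(4)
    by (rule prod_power_binary_form[OF \<open>b \<noteq> 0\<close>, of "{1..l}" c a t d k]) auto
  have "to_ac (f n) = (\<Sum>i=0..K. \<Sum>j=0..i. (-1) ^ j * (a * b) ^ (j * (j - 1) div 2) *
            hbinom a b (K + 1) j * to_ac (f (i - j)) * hbinom a b (n + K - i) K)"
    by (rule hbinom_expansion[where f = "\<lambda>n. to_ac (f n)", OF ne e])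
  also have "\<dots> = to_ac (\<Sum>i=0..K. \<Sum>j=0..i. (-1) ^ j * ((- Y) ^ s) ^ (j * (j - 1) div 2) *
            fibopoly s (K + 1) j * f (i - j) * fibopoly s (n + K - i) K)"
    by (simp add: to_ac_sum ab to_ac_fibopoly[OF \<alpha>\<beta>] flip: a_def b_def)
  \<comment> \<open>The embedding \<open>to_ac\<close> is injective, so the identity descends to the
    field of rational functions.\<close>
  finally have "f n = (\<Sum>i=0..K. \<Sum>j=0..i. (-1) ^ j * ((- Y) ^ s) ^ (j * (j - 1) div 2) *
            fibopoly s (K + 1) j * f (i - j) * fibopoly s (n + K - i) K)"
    by simp
  also have "\<dots> = (- 1) ^ (s + 1) * (\<Sum>i=0..K. \<Sum>j=0..i.
       (- 1) ^ ((s * j + 2 * (s + 1)) * (j + 1) div 2) * fibopoly s (K + 1) j * f (i - j) *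
       Y ^ (s * j * (j - 1) div 2) * fibopoly s (n + K - i) K)"
    unfolding sign_exponent[symmetric] sum_distrib_left by (simp only: mult_ac)
  finally show ?thesis
    unfolding f_def by (simp only: add.commute)
qed

end
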